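(* For the normal, misère and escape games on a Galton-Watson tree with any fixed offspring distribution $\mathbf p$, we have: (i) $N\le S^{(1)}$ and $\widetilde N\le S^{(1)}$; $P\le S^{(2)}$ and $\widetilde P\le S^{(2)}$; (ii) $S^{(2)}\le S^{(1)}$; $\widetilde P\le\widetilde N$; (iii) $\widetilde P\le P$ and $\widetilde P\le N$; $D\le\widetilde D$. Besides these inequalities and those implied by them, no other inequalities between pairs of the $10$ outcome probabilities $N,P,D,\widetilde N,\widetilde P,\widetilde D,S^{(1)},S^{(2)},E^{(1)},E^{(2)}$ hold in general: that is, for every ordered pair $(A,B)$ of distinct quantities among these ten such that $A\le B$ is not one of the inequalities in (i)--(iii) nor implied by them, there exists an offspring distribution for which $A>B$.
   Context: An offspring distribution is a probability mass function $\mathbf p=(p_0,p_1,\dots)$ on $\{0,1,2,\dots\}$. Let $\mathcal T$ be the Galton-Watson tree with offspring distribution $\mathbf p$, with edges directed from parents to children and root $o$. A token starts at $o$, and two players alternately move the token along a directed edge to a child of its current vertex. The tree is fully known to both players. A strategy for a player assigns to every vertex that has a child a legal move; it is winning if it yields a win for that player whatever strategy the opponent uses. Normal game: a player who cannot move loses and the other wins. Misère game: a player who cannot move wins and the other loses. In both, the game is a win for a player who has a winning strategy, and a draw if neither player has a winning strategy. Escape game: the players are Stopper and Escaper; Stopper wins if either player is ever unable to move; the game is a win for Escaper if Stopper has no winning strategy. $N$, $P$, $D=1-N-P$ are the probabilities (over $\mathcal T$) that the normal game is a win for the player moving first (Next), a win for the player moving second (Previous), a draw, respectively. $\widetilde N,\widetilde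 P,\widetilde D$ are the analogous probabilities for the misère game. $S^{(1)}$ (resp. $S^{(2)}$) is the probability that Stopper wins the escape game when Stopper moves first (resp. second). $E^{(1)}=1-S^{(2)}$ and $E^{(2)}=1-S^{(1)}$ are the win probabilities for Escaper when Escaper moves first or second respectively. "Implied by them" means following from (i)--(iii) by transitivity and the identities $E^{(1)}=1-S^{(2)}$, $E^{(2)}=1-S^{(1)}$ (so the implied ones are $P\le S^{(1)}$, $\widetilde P\le S^{(1)}$ and $E^{(2)}\le E^{(1)}$). *)

theory Defs
  imports "HOL-Probability.Probability"
begin

text \<open>
  Vertices are Ulam--Harris words: the root is the empty word and the children of \<open>v\<close> are
  \<open>v @ [0], \<dots>, v @ [c v - 1]\<close>. A rooted ordered tree is given by a
  function \<open>c\<close> assigning a number of children to every word; the values of \<open>c\<close> at words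
  outside the tree are irrelevant.
\<close>

type_synonym vertex = "nat list"
type_synonym offspring_numbers = "vertex \<Rightarrow> nat"
type_synonym strategy = "vertex \<Rightarrow> vertex"

definition tree :: "offspring_numbers \<Rightarrow> vertex set" where
  "tree c = {v. \<forall>i < length v. v ! i < c (take i v)}"

definition children :: "offspring_numbers \<Rightarrow> vertex \<Rightarrow> vertex set" where
  "children c v = {v @ [i] | i. i < c v}"

text \<open>The law of the Galton--Watson tree: the offspring numbers are i.i.d. with law \<open>p\<close>.\<close>

definition GW :: "nat pmf \<Rightarrow> offspring_numbers measure" where
  "GW p = (\<Pi>\<^sub>M v\<in>(UNIV :: vertex set). measure_pmf p)"

definition is_strategy :: "offspring_numbers \<Rightarrow> strategy \<Rightarrow> bool" where
  "is_strategy c \<sigma> \<longleftrightarrow> (\<forall>v \<in> tree c. children c v \<noteq> {} \<longrightarrow> \<sigma> v \<in> children c v)"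

text \<open>
  \<open>play c \<sigma> \<tau> n\<close> is the position of the token after \<open>n\<close> moves, where \<open>\<sigma>\<close> is the strategy of the
  player moving first and \<open>\<tau>\<close> that of the player moving second; it is \<open>None\<close> if the game stops
  before \<open>n\<close> moves have been made. The first player is to move after \<open>n\<close> moves iff \<open>n\<close> is even.
\<close>

primrec play :: "offspring_numbers \<Rightarrow> strategy \<Rightarrow> strategy \<Rightarrow> nat \<Rightarrow> vertex option" where
  "play c \<sigma> \<tau> 0 = Some []"
| "play c \<sigma> \<tau> (Suc n) =
    (case play c \<sigma> \<tau> n of
       None \<Rightarrow> None
     | Some v \<Rightarrow> if children c v = {} then None else Some (if even n then \<sigma> v else \<tau> v))"

definition first_stuck :: "offspring_numbers \<Rightarrow> strategy \<Rightarrow> strategy \<Rightarrow> bool" where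
  "first_stuck c \<sigma> \<tau> \<longleftrightarrow> (\<exists>n v. even n \<and> play c \<sigma> \<tau> n = Some v \<and> children c v = {})"

definition second_stuck :: "offspring_numbers \<Rightarrow> strategy \<Rightarrow> strategy \<Rightarrow> bool" where
  "second_stuck c \<sigma> \<tau> \<longleftrightarrow> (\<exists>n v. odd n \<and> play c \<sigma> \<tau> n = Some v \<and> children c v = {})"

definition someone_stuck :: "offspring_numbers \<Rightarrow> strategy \<Rightarrow> strategy \<Rightarrow> bool" where
  "someone_stuck c \<sigma> \<tau> \<longleftrightarrow> first_stuck c \<sigma> \<tau> \<or> second_stuck c \<sigma> \<tau>"

text \<open>
  The argument \<open>W c \<sigma> \<tau>\<close> is the winning condition of the player under consideration, as a
  predicate of the play in which the first player uses \<open>\<sigma>\<close> and the second player uses \<open>\<tau>\<close>.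
\<close>

definition first_wins ::
  "(offspring_numbers \<Rightarrow> strategy \<Rightarrow> strategy \<Rightarrow> bool) \<Rightarrow> offspring_numbers \<Rightarrow> bool" where
  "first_wins W c \<longleftrightarrow> (\<exists>\<sigma>. is_strategy c \<sigma> \<and> (\<forall>\<tau>. is_strategy c \<tau> \<longrightarrow> W c \<sigma> \<tau>))"

definition second_wins ::
  "(offspring_numbers \<Rightarrow> strategy \<Rightarrow> strategy \<Rightarrow> bool) \<Rightarrow> offspring_numbers \<Rightarrow> bool" where
  "second_wins W c \<longleftrightarrow> (\<exists>\<tau>. is_strategy c \<tau> \<and> (\<forall>\<sigma>. is_strategy c \<sigma> \<longrightarrow> W c \<sigma> \<tau>))"

text \<open>
  The ten outcomes. \<open>Stopper1\<close>, \<open>Escaper1\<close> (\<open>Stopper2\<close>, \<open>Escaper2\<close>) mean that the named player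
  wins the escape game when moving first (second). Escaper wins iff Stopper, who then has the
  other position in the order of play, has no winning strategy.
\<close>

datatype outcome =
    NormalN | NormalP | NormalD
  | MisereN | MisereP | MisereD
  | Stopper1 | Stopper2 | Escaper1 | Escaper2

fun occurs :: "outcome \<Rightarrow> offspring_numbers \<Rightarrow> bool" where
  "occurs NormalN c \<longleftrightarrow> first_wins second_stuck c"
| "occurs NormalP c \<longleftrightarrow> second_wins first_stuck c"
| "occurs NormalD c \<longleftrightarrow> \<not> first_wins second_stuck c \<and> \<not> second_wins first_stuck c"
| "occurs MisereN c \<longleftrightarrow> first_wins first_stuck c"
| "occurs MisereP c \<longleftrightarrow> second_wins second_stuck c"
| "occurs MisereD c \<longleftrightarrow> \<not> first_wins first_stuck c \<and> \<not> second_wins second_stuck c"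
| "occurs Stopper1 c \<longleftrightarrow> first_wins someone_stuck c"
| "occurs Stopper2 c \<longleftrightarrow> second_wins someone_stuck c"
| "occurs Escaper1 c \<longleftrightarrow> \<not> second_wins someone_stuck c"
| "occurs Escaper2 c \<longleftrightarrow> \<not> first_wins someone_stuck c"

definition outcome_prob :: "nat pmf \<Rightarrow> outcome \<Rightarrow> real" where
  "outcome_prob p A = measure (GW p) {c \<in> space (GW p). occurs A c}"

definition listed_ineqs :: "(outcome \<times> outcome) set" where
  "listed_ineqs =
    {(NormalN, Stopper1), (MisereN, Stopper1), (NormalP, Stopper2), (MisereP, Stopper2),
     (Stopper2, Stopper1), (MisereP, MisereN),
     (MisereP, NormalP), (MisereP, NormalN), (NormalD, MisereD)}"

text \<open>Pairs of outcomes whose probabilities add up to 1 in the escape game.\<close>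

definition complementary :: "(outcome \<times> outcome) set" where
  "complementary =
    {(Escaper1, Stopper2), (Stopper2, Escaper1), (Escaper2, Stopper1), (Stopper1, Escaper2)}"

text \<open>
  \<open>implied_ineq A B\<close> says that the inequality between the probabilities of \<open>A\<close> and \<open>B\<close> (in this
  order) is listed or follows from the listed ones.
\<close>

inductive implied_ineq :: "outcome \<Rightarrow> outcome \<Rightarrow> bool" where
  implied_listed: "(A, B) \<in> listed_ineqs \<Longrightarrow> implied_ineq A B"
| implied_trans: "implied_ineq A B \<Longrightarrow> implied_ineq B C \<Longrightarrow> implied_ineq A C"
| implied_complement: "implied_ineq A B \<Longrightarrow> (A, A') \<in> complementary \<Longrightarrow> (B, B') \<in> complementary
    \<Longrightarrow> implied_ineq B' A'"

lemma implied_ineq_iff: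
  "implied_ineq A B \<longleftrightarrow>
    (A, B) \<in> listed_ineqs \<union>
      {(NormalP, Stopper1), (MisereP, Stopper1), (Escaper2, Escaper1)}"
proof
  assume "implied_ineq A B"
  then show "(A, B) \<in> listed_ineqs \<union>
      {(NormalP, Stopper1), (MisereP, Stopper1), (Escaper2, Escaper1)}"
    by induction (auto simp: listed_ineqs_def complementary_def)
next
  have "implied_ineq NormalP Stopper1" "implied_ineq MisereP Stopper1"
    by (rule implied_trans[of _ Stopper2]; rule implied_listed; simp add: listed_ineqs_def)+
  moreover have "implied_ineq Escaper2 Escaper1"
    by (rule implied_complement[of Stopper2 Stopper1])
      (auto intro: implied_listed simp: listed_ineqs_def complementary_def)
  moreover assume "(A, B) \<in> listed_ineqs \<union>
      {(NormalP, Stopper1), (MisereP, Stopper1), (Escaper2, Escaper1)}"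
  ultimately show "implied_ineq A B"
    by (auto intro: implied_listed)
qed

end

theory Submission
  imports Defs
begin

text \<open>
  Since the tree is locally finite, a player who wants the token to get stuck wins iff he can force
  it within boundedly many moves. Splitting at the root, the winning probabilities form the least
  solution of a two-dimensional system in the generating function \<open>G\<close>. Put \<open>R x = 1 - G x\<close>, a
  decreasing concave function, and \<open>e = p\<^sub>0\<close>. In the normal game \<open>(N, 1 - P)\<close> is the extremal
  2-cycle of \<open>R\<close>, in the misere game it is the extremal 2-cycle of \<open>R + e\<close>. When the graph of \<open>R\<close>
  is raised by \<open>e\<close>, concavity pushes a 2-cycle \<open>U < V\<close> to one with larger gap whose upper point is
  at least \<open>V + e / 2\<close>; this gives (iii). The strict inequalities come from six distributions, for
  which upper bounds follow from minimality of the solution and lower bounds by iterating the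
  system from 0.
\<close>

subsection \<open>Determinacy in bounded time\<close>

definition subtree :: "offspring_numbers \<Rightarrow> vertex \<Rightarrow> offspring_numbers" where
  "subtree c v = (\<lambda>w. c (v @ w))"

text \<open>
  All games are treated at once from the point of view of one player, the hero: \<open>m\<close> says whether the
  hero is to move, and \<open>g m\<close> whether he wins if the player to move is stuck. Thus \<open>g\<close> is negation
  in the normal game, the identity in the misere game and constantly true for Stopper.
\<close>

primrec forces :: "(bool \<Rightarrow> bool) \<Rightarrow> nat \<Rightarrow> bool \<Rightarrow> offspring_numbers \<Rightarrow> bool" where
  "forces g 0 m c = False"
| "forces g (Suc n) m c =
    (if c [] = 0 then g m
     else if m then \<exists>i < c []. forces g n False (subtree c [i])
     else \<forall>i < c []. forces g n True (subtree c [i]))"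

definition eventually_forces :: "(bool \<Rightarrow> bool) \<Rightarrow> bool \<Rightarrow> offspring_numbers \<Rightarrow> bool" where
  "eventually_forces g m c \<longleftrightarrow> (\<exists>n. forces g n m c)"

lemma subtree_apply_Nil [simp]: "subtree c v [] = c v"
  by (simp add: subtree_def)

lemma subtree_subtree [simp]: "subtree (subtree c v) w = subtree c (v @ w)"
  by (simp add: subtree_def)

lemma subtree_Nil [simp]: "subtree c [] = c"
  by (simp add: subtree_def)

lemma forces_Suc: "forces g n m c \<Longrightarrow> forces g (Suc n) m c"
proof (induction n arbitrary: m c)
  case (Suc n)
  have step: "forces g n m' (subtree c [i]) \<Longrightarrow> forces g (Suc n) m' (subtree c [i])" for m' i
    by (rule Suc.IH)
  show ?case
  proof (cases "c [] = 0")
    case True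
    with Suc.prems show ?thesis
      by simp
  next
    case False
    with Suc.prems step show ?thesis
      unfolding forces.simps(2)[of g "Suc n"] forces.simps(2)[of g n m c] if_not_P[OF False]
      by (cases m) (simp_all only: if_True if_False, blast+)
  qed
qed simp

lemma forces_mono:
  assumes "forces g n m c" "n \<le> n'"
  shows "forces g n' m c"
  using assms(2,1) by (induction rule: dec_induct) (auto intro: forces_Suc simp del: forces.simps)

text \<open>Local finiteness enters here: at an opponent's vertex the finitely many children have
  their own bounds, and the maximum of these serves for all.\<close>

lemma eventually_forces_iff:
  "eventually_forces g m c \<longleftrightarrow>
    (if c [] = 0 then g m
     else if m then \<exists>i < c []. eventually_forces g False (subtree c [i])
     else \<forall>i < c []. eventually_forces g True (subtree c [i]))"
    (is "_ \<longleftrightarrow> ?rhs")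
proof
  assume "eventually_forces g m c"
  then obtain n where n: "forces g n m c"
    by (auto simp: eventually_forces_def)
  then obtain k where "forces g (Suc k) m c"
    by (cases n) (simp, blast)
  then show ?rhs
    unfolding eventually_forces_def forces.simps(2)[of g k m c] by meson
next
  assume r: ?rhs
  have "\<exists>n. forces g (Suc n) m c"
  proof (cases "c [] \<noteq> 0 \<and> \<not> m")
    case True
    with r have "\<forall>i\<in>{..<c []}. \<exists>n. forces g n True (subtree c [i])"
      by (simp add: eventually_forces_def)
    then obtain N where N: "\<forall>i\<in>{..<c []}. forces g (N i) True (subtree c [i])"
      by (rule bchoice[THEN exE])
    have "forces g (Max (N ` {..<c []})) True (subtree c [i])" if "i < c []" for i
      by (rule forces_mono[OF bspec[OF N]]) (use that in auto)
    with True have "forces g (Suc (Max (N ` {..<c []}))) m c"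
      by simp
    then show ?thesis ..
  next
    case False
    show ?thesis
    proof (cases "c [] = 0")
      case True
      with r show ?thesis
        by simp
    next
      case nz: False
      with False have m
        by simp
      with r nz obtain i n where "i < c []" "forces g n False (subtree c [i])"
        by (auto simp: eventually_forces_def)
      with nz \<open>m\<close> have "forces g (Suc n) m c"
        by auto
      then show ?thesis ..
    qed
  qed
  then show "eventually_forces g m c"
    unfolding eventually_forces_def by (elim exE) (rule exI)
qed

text \<open>The argument \<open>q\<close> says whether the hero moves first.\<close>

definition hero_play ::
  "offspring_numbers \<Rightarrow> bool \<Rightarrow> strategy \<Rightarrow> strategy \<Rightarrow> nat \<Rightarrow> vertex option" where
  "hero_play c q \<sigma> \<tau> = (if q then play c \<sigma> \<tau> else play c \<tau> \<sigma>)"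

lemma hero_play_0 [simp]: "hero_play c q \<sigma> \<tau> 0 = Some []"
  by (simp add: hero_play_def)

lemma hero_play_Suc [simp]:
  "hero_play c q \<sigma> \<tau> (Suc n) =
    (case hero_play c q \<sigma> \<tau> n of
       None \<Rightarrow> None
     | Some v \<Rightarrow> if children c v = {} then None else Some (if even n = q then \<sigma> v else \<tau> v))"
  by (auto simp: hero_play_def split: option.split)

definition hero_wins ::
  "(bool \<Rightarrow> bool) \<Rightarrow> offspring_numbers \<Rightarrow> bool \<Rightarrow> strategy \<Rightarrow> strategy \<Rightarrow> bool" where
  "hero_wins g c q \<sigma> \<tau> \<longleftrightarrow>
    (\<exists>n v. hero_play c q \<sigma> \<tau> n = Some v \<and> children c v = {} \<and> g (even n = q))"

lemma children_eq_empty_iff [simp]: "children c v = {} \<longleftrightarrow> c v = 0"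
  by (auto simp: children_def)

lemma children_tree: "v \<in> tree c \<Longrightarrow> w \<in> children c v \<Longrightarrow> w \<in> tree c"
  by (auto simp: tree_def children_def nth_append less_Suc_eq)

lemma Nil_in_tree [simp]: "[] \<in> tree c"
  by (simp add: tree_def)

lemma strategy_choice:
  assumes "\<And>v. v \<in> tree c \<Longrightarrow> c v \<noteq> 0 \<Longrightarrow> \<exists>w \<in> children c v. Q v w"
  obtains \<sigma> where "is_strategy c \<sigma>" "\<And>v. v \<in> tree c \<Longrightarrow> c v \<noteq> 0 \<Longrightarrow> Q v (\<sigma> v)"
proof -
  have "\<forall>v. \<exists>w. v \<in> tree c \<and> c v \<noteq> 0 \<longrightarrow> w \<in> children c v \<and> Q v w"
    using assms by blast
  then obtain \<sigma> where "\<forall>v. v \<in> tree c \<and> c v \<noteq> 0 \<longrightarrow> \<sigma> v \<in> children c v \<and> Q v (\<sigma> v)"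
    by (rule choice[THEN exE])
  then show thesis
    by (intro that[of \<sigma>]) (auto simp: is_strategy_def)
qed

text \<open>While nobody is stuck, every move of either player lowers the bound \<open>n\<close> for
  the current position by one. Since \<open>forces g 0\<close> is false, the play ends, and at a
  vertex where \<open>g\<close> favours the hero.\<close>

lemma forces_imp_strategy:
  assumes "eventually_forces g q c"
  shows "\<exists>\<sigma>. is_strategy c \<sigma> \<and> (\<forall>\<tau>. is_strategy c \<tau> \<longrightarrow> hero_wins g c q \<sigma> \<tau>)"
proof -
  \<comment> \<open>Quantifying over all \<open>n\<close> makes the chosen child independent of the
    bound: a child that is good for the least \<open>n\<close> is good for every larger one.\<close>
  let ?Q = "\<lambda>v w. \<forall>n. forces g (Suc n) True (subtree c v) \<longrightarrow> forces g n False (subtree c w)"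
  have "\<exists>w \<in> children c v. ?Q v w" if "c v \<noteq> 0" for v
  proof (cases "\<exists>n. forces g (Suc n) True (subtree c v)")
    case True
    define n where "n = (LEAST n. forces g (Suc n) True (subtree c v))"
    have "forces g (Suc n) True (subtree c v)"
      unfolding n_def using True by (rule LeastI_ex)
    with that obtain i where i: "i < c v" "forces g n False (subtree c (v @ [i]))"
      by auto
    have "n \<le> k" if "forces g (Suc k) True (subtree c v)" for k
      unfolding n_def using that by (rule Least_le)
    with i(2) have "?Q v (v @ [i])"
      using forces_mono by blast
    with i(1) show ?thesis
      by (auto simp: children_def simp del: forces.simps)
  next
    case False
    with that show ?thesis
      by (auto simp: children_def simp del: forces.simps intro!: exI[of _ 0])
  qed
  then obtain \<sigma> where \<sigma>: "is_strategy c \<sigma>" "\<And>v. v \<in> tree c \<Longrightarrow> c v \<noteq> 0 \<Longrightarrow> ?Q v (\<sigma> v)"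
    by (rule strategy_choice[of c ?Q]) auto
  have "hero_wins g c q \<sigma> \<tau>" if \<tau>: "is_strategy c \<tau>" for \<tau>
  proof -
    have "hero_wins g c q \<sigma> \<tau>"
      if "hero_play c q \<sigma> \<tau> k = Some v" "v \<in> tree c" "forces g n (even k = q) (subtree c v)"
      for n k v
      using that
    proof (induction n arbitrary: k v)
      case (Suc n)
      show ?case
      proof (cases "c v = 0")
        case True
        with Suc.prems show ?thesis
          unfolding hero_wins_def by (intro exI[of _ k] exI[of _ v]) auto
      next
        case False
        define w where "w = (if even k = q then \<sigma> v else \<tau> v)"
        have w: "w \<in> children c v"
          using \<sigma>(1) \<tau> False Suc.prems(2) by (auto simp: is_strategy_def w_def)
        have "forces g n (even (Suc k) = q) (subtree c w)"
        proof (cases "even k = q")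
          case True
          then have "(even (Suc k) = q) = False"
            by auto
          with True show ?thesis
            using \<sigma>(2)[OF Suc.prems(2) False] Suc.prems(3)
            by (simp add: w_def del: forces.simps)
        next
          case neq: False
          then have "(even (Suc k) = q) = True" "(even k = q) = False"
            by auto
          with w Suc.prems(3) False show ?thesis
            by (auto simp: children_def)
        qed
        moreover have "hero_play c q \<sigma> \<tau> (Suc k) = Some w"
          using Suc.prems(1) False by (simp add: w_def)
        ultimately show ?thesis
          using Suc.IH children_tree[OF Suc.prems(2) w] by blast
      qed
    qed simp
    from this[of 0 "[]"] assms show ?thesis
      by (auto simp: eventually_forces_def)
  qed
  with \<sigma>(1) show ?thesis
    by blast
qed

text \<open>By contraposition: from a position that the hero cannot force, the opponent can move to
  another such position, and every move of the hero leads to one. A stuck position with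
  \<open>g\<close> true would be forced, so it never occurs.\<close>

lemma strategy_imp_forces:
  assumes "is_strategy c \<sigma>" "\<And>\<tau>. is_strategy c \<tau> \<Longrightarrow> hero_wins g c q \<sigma> \<tau>"
  shows "eventually_forces g q c"
proof (rule ccontr)
  assume neg: "\<not> eventually_forces g q c"
  let ?E = "\<lambda>m v. eventually_forces g m (subtree c v)"
  let ?Q = "\<lambda>v w. \<not> ?E False v \<longrightarrow> \<not> ?E True w"
  have "\<exists>w \<in> children c v. ?Q v w" if "c v \<noteq> 0" for v
    using that eventually_forces_iff[of g False "subtree c v"] by (auto simp: children_def)
  then obtain \<tau> where \<tau>: "is_strategy c \<tau>" "\<And>v. v \<in> tree c \<Longrightarrow> c v \<noteq> 0 \<Longrightarrow> ?Q v (\<tau> v)"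
    by (rule strategy_choice[of c ?Q]) auto
  have inv: "v \<in> tree c \<and> \<not> ?E (even k = q) v" if "hero_play c q \<sigma> \<tau> k = Some v" for k v
    using that
  proof (induction k arbitrary: v)
    case 0
    with neg show ?case
      by simp
  next
    case (Suc k)
    then obtain u where u: "hero_play c q \<sigma> \<tau> k = Some u" "c u \<noteq> 0"
      "v = (if even k = q then \<sigma> u else \<tau> u)"
      by (auto split: option.splits if_splits)
    note IH = Suc.IH[OF u(1)]
    have v: "v \<in> children c u"
      using assms(1) \<tau>(1) u IH by (auto simp: is_strategy_def)
    have "\<not> ?E (even (Suc k) = q) v"
    proof (cases "even k = q")
      case True
      then have "(even (Suc k) = q) = False"
        by auto
      with IH True v u(2) show ?thesis
        using eventually_forces_iff[of g True "subtree c u"] by (auto simp: children_def)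
    next
      case False
      then have "(even (Suc k) = q) = True" "(even k = q) = False"
        by auto
      with IH u \<tau>(2)[of u] show ?thesis
        by simp
    qed
    with IH v show ?case
      using children_tree by blast
  qed
  from assms(2)[OF \<tau>(1)] obtain n v where
    "hero_play c q \<sigma> \<tau> n = Some v" "c v = 0" "g (even n = q)"
    by (auto simp: hero_wins_def)
  with inv[of n v] eventually_forces_iff[of g "even n = q" "subtree c v"] show False
    by simp
qed

lemma first_wins_iff_forces:
  assumes "\<And>\<sigma> \<tau>. W c \<sigma> \<tau> = hero_wins g c True \<sigma> \<tau>"
  shows "first_wins W c \<longleftrightarrow> eventually_forces g True c"
  unfolding first_wins_def assms using forces_imp_strategy strategy_imp_forces by blast

lemma second_wins_iff_forces:
  assumes "\<And>\<sigma> \<tau>. W c \<sigma> \<tau> = hero_wins g c False \<tau> \<sigma>"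
  shows "second_wins W c \<longleftrightarrow> eventually_forces g False c"
  unfolding second_wins_def assms using forces_imp_strategy strategy_imp_forces by blast

lemmas hero_wins_defs = hero_wins_def hero_play_def first_stuck_def second_stuck_def
  someone_stuck_def

lemma first_wins_forces:
  "first_wins second_stuck c \<longleftrightarrow> eventually_forces Not True c"
  "first_wins first_stuck c \<longleftrightarrow> eventually_forces (\<lambda>m. m) True c"
  "first_wins someone_stuck c \<longleftrightarrow> eventually_forces (\<lambda>_. True) True c"
  by (intro first_wins_iff_forces; auto simp: hero_wins_defs)+

lemma second_wins_forces:
  "second_wins first_stuck c \<longleftrightarrow> eventually_forces Not False c"
  "second_wins second_stuck c \<longleftrightarrow> eventually_forces (\<lambda>m. m) False c"
  "second_wins someone_stuck c \<longleftrightarrow> eventually_forces (\<lambda>_. True) False c"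
  by (intro second_wins_iff_forces; auto simp: hero_wins_defs)+

subsection \<open>Recursion for the winning probabilities\<close>

lemma space_GW [simp]: "space (GW p) = UNIV"
  by (simp add: GW_def space_PiM PiE_def extensional_def)

lemma prob_space_GW: "prob_space (GW p)"
  unfolding GW_def by (intro prob_space_PiM prob_space_measure_pmf)

lemma measurable_apply_GW [measurable]: "(\<lambda>c. c v) \<in> GW p \<rightarrow>\<^sub>M count_space UNIV"
proof -
  have "(\<lambda>c. c v) \<in> GW p \<rightarrow>\<^sub>M measure_pmf p"
    unfolding GW_def by measurable
  then show ?thesis
    by simp
qed

lemma measurable_subtree_GW [measurable]: "(\<lambda>c. subtree c v) \<in> GW p \<rightarrow>\<^sub>M GW p"
  unfolding GW_def subtree_def
  by (intro measurable_PiM_single' measurable_component_singleton) (auto simp: space_PiM)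

lemma sets_GW_Collect: "Measurable.pred (GW p) A \<Longrightarrow> {c. A c} \<in> sets (GW p)"
  by (simp add: pred_def)

lemma distr_apply_GW: "distr (GW p) (measure_pmf p) (\<lambda>c. c v) = measure_pmf p"
  unfolding GW_def by (rule distr_PiM_component) (auto intro: prob_space_measure_pmf)

text \<open>Pulling an i.i.d. family back along the injection \<open>append v\<close> keeps its law,
  whether or not \<open>v\<close> lies in the tree.\<close>

lemma distr_subtree_GW: "distr (GW p) (GW p) (\<lambda>c. subtree c v) = GW p"
  using distr_PiM_reindex[of UNIV "\<lambda>_. measure_pmf p" "append v" UNIV]
  by (simp add: GW_def subtree_def prob_space_measure_pmf restrict_UNIV inj_def)

section \<open>The probability generating function\<close>

definition pgf :: "nat pmf \<Rightarrow> real \<Rightarrow> real" where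
  "pgf p x = measure_pmf.expectation p (\<lambda>k. x ^ k)"

lemma integrable_power_pmf:
  fixes x :: real
  assumes "0 \<le> x" "x \<le> 1"
  shows "integrable (measure_pmf p) (\<lambda>k. x ^ k)"
  using assms
  by (intro measure_pmf.integrable_const_bound[where B = 1]) (auto simp: power_le_one)

lemma pgf_sums:
  assumes "0 \<le> x" "x \<le> 1"
  shows "(\<lambda>k. pmf p k * x ^ k) sums pgf p x"
proof -
  have "integrable (count_space UNIV) (\<lambda>k. pmf p k * x ^ k)"
    using integrable_power_pmf[OF assms, of p] integrable_density[of "\<lambda>k. x ^ k" "count_space UNIV" "pmf p"]
    by (simp add: measure_pmf_eq_density)
  moreover have "pgf p x = (\<integral>k. pmf p k * x ^ k \<partial>count_space UNIV)"
    using integral_density[of "\<lambda>k. x ^ k" "count_space UNIV" "pmf p"]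
    by (simp add: pgf_def measure_pmf_eq_density)
  ultimately show ?thesis
    by (simp add: sums_integral_count_space_nat)
qed

lemma pgf_mono:
  assumes "0 \<le> x" "x \<le> y" "y \<le> 1"
  shows "pgf p x \<le> pgf p y"
  unfolding pgf_def using assms
  by (intro integral_mono integrable_power_pmf power_mono) auto

lemma pgf_0 [simp]: "pgf p 0 = pmf p 0"
proof -
  have "pgf p 0 = measure_pmf.expectation p (indicator {0})"
    unfolding pgf_def by (intro Bochner_Integration.integral_cong) (auto simp: indicator_def)
  then show ?thesis
    by (simp add: pmf.rep_eq)
qed

lemma pgf_1 [simp]: "pgf p 1 = 1"
  by (simp add: pgf_def)

lemma convex_on_power: "convex_on {0..1 :: real} (\<lambda>x. x ^ k)"
  by (cases "even k")
    (auto intro: convex_on_subset[OF convex_power_even] convex_on_subset[OF convex_power_odd])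

lemma convex_on_pgf: "convex_on {0..1} (pgf p)"
proof (rule convex_onI)
  fix t x y :: real
  assume *: "0 < t" "t < 1" "x \<in> {0..1}" "y \<in> {0..1}"
  have "((1 - t) *\<^sub>R x + t *\<^sub>R y) ^ k \<le> (1 - t) * x ^ k + t * y ^ k" for k
    using * by (intro convex_onD[OF convex_on_power]) auto
  moreover have "(1 - t) *\<^sub>R x + t *\<^sub>R y \<in> {0..1}"
    using * by (intro convexD_alt) auto
  ultimately have "pgf p ((1 - t) *\<^sub>R x + t *\<^sub>R y) \<le>
      measure_pmf.expectation p (\<lambda>k. (1 - t) * x ^ k + t * y ^ k)"
    unfolding pgf_def using *
    by (intro integral_mono integrable_power_pmf Bochner_Integration.integrable_add
        Bochner_Integration.integrable_mult_right) auto
  also have "\<dots> = (1 - t) * pgf p x + t * pgf p y"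
    unfolding pgf_def using *
    by (subst Bochner_Integration.integral_add)
      (auto intro!: integrable_power_pmf Bochner_Integration.integrable_mult_right)
  finally show "pgf p ((1 - t) *\<^sub>R x + t *\<^sub>R y) \<le> (1 - t) * pgf p x + t * pgf p y" .
qed simp

section \<open>Measurability, and independence in the first generation\<close>

lemma measurable_pred_forces [measurable]: "Measurable.pred (GW p) (forces g n m)"
proof (induction n arbitrary: m)
  case (Suc n)
  note Suc.IH [measurable]
  have "Measurable.pred (GW p) (\<lambda>c. if c [] = 0 then g m
     else if m then \<exists>i. i < c [] \<and> forces g n False (subtree c [i])
     else \<forall>i. i < c [] \<longrightarrow> forces g n True (subtree c [i]))"
    by measurable
  then show ?case
    by simp
next
  case 0
  have "forces g 0 m = (\<lambda>_. False)"
    by (simp add: fun_eq_iff)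
  then show ?case
    by simp
qed

lemma measurable_pred_eventually_forces [measurable]:
  "Measurable.pred (GW p) (eventually_forces g m)"
  unfolding eventually_forces_def by measurable

text \<open>The root and the sets of words with a given first letter are disjoint blocks of
  coordinates, so the number of children and the subtrees are independent.\<close>

lemma prob_first_generation:
  assumes [measurable]: "Measurable.pred (GW p) A"
  shows "measure (GW p) {c. c [] = k \<and> (\<forall>i < k. A (subtree c [i]))} =
    pmf p k * measure (GW p) {c. A c} ^ k"
proof -
  interpret prob_space "GW p"
    by (rule prob_space_GW)
  \<comment> \<open>\<open>None\<close> indexes the block of the root, \<open>Some i\<close> that of
    the words starting with \<open>i\<close>.\<close>
  define K where "K j = (case j of None \<Rightarrow> {[]} | Some i \<Rightarrow> range ((#) i))" for j :: "nat option"
  have ind: "indep_vars (\<lambda>v. measure_pmf p) (\<lambda>v c. c v) UNIV"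
    using distr_id[of "GW p"]
    by (subst indep_vars_iff_distr_eq_PiM')
      (auto simp: distr_apply_GW restrict_UNIV id_def GW_def[symmetric])
  have ind2: "indep_vars (\<lambda>j. PiM (K j) (\<lambda>_. measure_pmf p)) (\<lambda>j c. restrict (\<lambda>v. c v) (K j)) UNIV"
    by (rule indep_vars_restrict[OF ind]) (auto simp: disjoint_family_on_def K_def split: option.splits)
  define X where "X j = (case j of None \<Rightarrow> (\<lambda>c. c [] = k) | Some i \<Rightarrow> (\<lambda>c. A (\<lambda>w. c (i # w))))"
    for j :: "nat option"
  have X: "Measurable.pred (PiM (K j) (\<lambda>_. measure_pmf p)) (X j)" for j
  proof (cases j)
    case None
    have "(\<lambda>c. c []) \<in> PiM {[]} (\<lambda>_. measure_pmf p) \<rightarrow>\<^sub>M measure_pmf p"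
      by (rule measurable_component_singleton) simp
    then have [measurable]: "(\<lambda>c. c []) \<in> PiM {[]} (\<lambda>_. measure_pmf p) \<rightarrow>\<^sub>M count_space UNIV"
      by simp
    show ?thesis
      unfolding X_def K_def None by simp
  next
    case (Some i)
    have "(\<lambda>c w. c (i # w)) \<in> PiM (range ((#) i)) (\<lambda>_. measure_pmf p) \<rightarrow>\<^sub>M GW p"
      unfolding GW_def
      by (intro measurable_PiM_single' measurable_component_singleton) (auto simp: space_PiM)
    then show ?thesis
      unfolding X_def K_def Some by simp measurable
  qed
  have ind3: "indep_vars (\<lambda>_. count_space UNIV) (\<lambda>j c. X j (restrict (\<lambda>v. c v) (K j))) UNIV"
    using ind2 X by (rule indep_vars_compose2)
  have eq: "X j (restrict (\<lambda>v. c v) (K j)) = (case j of None \<Rightarrow> c [] = k | Some i \<Rightarrow> A (subtree c [i]))"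
    for j c
    by (auto simp: X_def K_def subtree_def split: option.splits)
  let ?Y = "\<lambda>j c. case j of None \<Rightarrow> c [] = k | Some i \<Rightarrow> A (subtree c [i])"
  let ?J = "insert None (Some ` {..<k})"
  have "prob (\<Inter>j\<in>?J. ?Y j -` {True} \<inter> space (GW p)) = (\<Prod>j\<in>?J. prob (?Y j -` {True} \<inter> space (GW p)))"
    using ind3 unfolding eq by (rule indep_varsD) auto
  moreover have "(\<Inter>j\<in>?J. ?Y j -` {True} \<inter> space (GW p)) = {c. c [] = k \<and> (\<forall>i < k. A (subtree c [i]))}"
    by auto
  moreover have "(\<Prod>j\<in>?J. prob (?Y j -` {True} \<inter> space (GW p))) =
      prob {c. c [] = k} * (\<Prod>i<k. prob {c. A (subtree c [i])})"
    by (simp add: prod.reindex vimage_def)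
  moreover have "prob {c. A (subtree c [i])} = prob {c. A c}" for i
  proof -
    have "prob {c. A c} = measure (distr (GW p) (GW p) (\<lambda>c. subtree c [i])) {c. A c}"
      by (simp add: distr_subtree_GW)
    also have "\<dots> = prob {c. A (subtree c [i])}"
      by (subst measure_distr) (auto simp: vimage_def intro: sets_GW_Collect)
    finally show ?thesis ..
  qed
  moreover have "prob {c. c [] = k} = pmf p k"
  proof -
    have "pmf p k = measure (distr (GW p) (measure_pmf p) (\<lambda>c. c [])) {k}"
      by (simp add: distr_apply_GW pmf.rep_eq)
    also have "\<dots> = prob {c. c [] = k}"
      by (subst measure_distr) (auto simp: vimage_def)
    finally show ?thesis ..
  qed
  ultimately show ?thesis
    by simp
qed

lemma prob_all_children:
  assumes [measurable]: "Measurable.pred (GW p) A"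
  shows "measure (GW p) {c. \<forall>i < c []. A (subtree c [i])} = pgf p (measure (GW p) {c. A c})"
proof -
  interpret prob_space "GW p"
    by (rule prob_space_GW)
  let ?B = "\<lambda>k. {c. c [] = k \<and> (\<forall>i < k. A (subtree c [i]))}"
  have "{c. \<forall>i < c []. A (subtree c [i])} = (\<Union>k. ?B k)"
    by auto
  moreover have "(\<lambda>k. prob (?B k)) sums prob (\<Union>k. ?B k)"
    by (intro finite_measure_UNION image_subsetI sets_GW_Collect)
      (measurable, auto simp: disjoint_family_on_def)
  moreover have "(\<lambda>k. pmf p k * prob {c. A c} ^ k) sums pgf p (prob {c. A c})"
    by (rule pgf_sums) auto
  ultimately show ?thesis
    by (simp add: prob_first_generation sums_unique2)
qed

lemma prob_root_childless: "measure (GW p) {c. c [] = 0} = pmf p 0"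
  using prob_first_generation[where p = p and A = "\<lambda>_. True" and k = 0] by simp

definition win_prob :: "(bool \<Rightarrow> bool) \<Rightarrow> nat pmf \<Rightarrow> bool \<Rightarrow> real" where
  "win_prob g p m = measure (GW p) {c. eventually_forces g m c}"

text \<open>The probability of winning in fewer than \<open>n\<close> moves; these are the iterates
  from 0 of the system for \<open>win_prob\<close>.\<close>

definition forces_prob :: "(bool \<Rightarrow> bool) \<Rightarrow> nat pmf \<Rightarrow> nat \<Rightarrow> bool \<Rightarrow> real" where
  "forces_prob g p n m = measure (GW p) {c. forces g n m c}"

text \<open>In the complement every child fails, which holds vacuously at a childless root; that
  event is added back when \<open>b\<close> holds.\<close>

lemma prob_some_child:
  assumes [measurable]: "Measurable.pred (GW p) A"
  shows "measure (GW p) {c. if c [] = 0 then b else \<exists>i < c []. A (subtree c [i])} =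
    of_bool b * pmf p 0 + 1 - pgf p (1 - measure (GW p) {c. A c})"
proof -
  interpret prob_space "GW p"
    by (rule prob_space_GW)
  let ?C = "{c. \<forall>i < c []. \<not> A (subtree c [i])}" and ?L = "{c. b \<and> c [] = 0}"
  have C: "?C \<in> events" and L: "?L \<in> events"
    by (intro sets_GW_Collect; measurable)+
  have "{c. if c [] = 0 then b else \<exists>i < c []. A (subtree c [i])} = (space (GW p) - ?C) \<union> ?L"
    by auto
  also have "prob \<dots> = prob (space (GW p) - ?C) + prob ?L"
    using sets.compl_sets[OF C] L by (intro finite_measure_Union) auto
  also have "prob ?L = of_bool b * pmf p 0"
    by (simp add: prob_root_childless)
  also have "prob (space (GW p) - ?C) = 1 - pgf p (prob {c. \<not> A c})"
    using C prob_all_children[where p = p and A = "\<lambda>c. \<not> A c"] by (subst prob_compl) auto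
  also have "prob {c. \<not> A c} = 1 - prob {c. A c}"
    using prob_neg[of A] sets_GW_Collect[OF assms] by simp
  finally show ?thesis
    by simp
qed

text \<open>A childless root satisfies the universal condition vacuously, so it is subtracted when
  \<open>b\<close> fails.\<close>

lemma prob_every_child:
  assumes [measurable]: "Measurable.pred (GW p) A"
  shows "measure (GW p) {c. if c [] = 0 then b else \<forall>i < c []. A (subtree c [i])} =
    pgf p (measure (GW p) {c. A c}) - of_bool (\<not> b) * pmf p 0"
proof -
  interpret prob_space "GW p"
    by (rule prob_space_GW)
  let ?C = "{c. \<forall>i < c []. A (subtree c [i])}" and ?L = "{c. \<not> b \<and> c [] = 0}"
  have "{c. if c [] = 0 then b else \<forall>i < c []. A (subtree c [i])} = ?C - ?L"
    by auto
  also have "prob \<dots> = prob ?C - prob ?L"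
    by (intro finite_measure_Diff sets_GW_Collect) (measurable, auto)
  also have "prob ?L = of_bool (\<not> b) * pmf p 0"
    by (simp add: prob_root_childless)
  finally show ?thesis
    by (simp add: prob_all_children)
qed

lemma win_prob_True:
  "win_prob g p True = of_bool (g True) * pmf p 0 + 1 - pgf p (1 - win_prob g p False)"
proof -
  have eq: "{c. eventually_forces g True c} =
      {c. if c [] = 0 then g True else \<exists>i < c []. eventually_forces g False (subtree c [i])}"
    by (rule Collect_cong) (subst eventually_forces_iff, simp)
  show ?thesis
    unfolding win_prob_def eq by (rule prob_some_child) (rule measurable_pred_eventually_forces)
qed

lemma win_prob_False:
  "win_prob g p False = pgf p (win_prob g p True) - of_bool (\<not> g False) * pmf p 0"
proof -
  have eq: "{c. eventually_forces g False c} =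
      {c. if c [] = 0 then g False else \<forall>i < c []. eventually_forces g True (subtree c [i])}"
    by (rule Collect_cong) (subst eventually_forces_iff, simp)
  show ?thesis
    unfolding win_prob_def eq by (rule prob_every_child) (rule measurable_pred_eventually_forces)
qed

lemma forces_prob_0 [simp]: "forces_prob g p 0 m = 0"
  by (simp add: forces_prob_def)

lemma forces_prob_Suc_True:
  "forces_prob g p (Suc n) True = of_bool (g True) * pmf p 0 + 1 - pgf p (1 - forces_prob g p n False)"
proof -
  have eq: "{c. forces g (Suc n) True c} =
      {c. if c [] = 0 then g True else \<exists>i < c []. forces g n False (subtree c [i])}"
    by simp
  show ?thesis
    unfolding forces_prob_def eq by (rule prob_some_child) (rule measurable_pred_forces)
qed

lemma forces_prob_Suc_False:
  "forces_prob g p (Suc n) False = pgf p (forces_prob g p n True) - of_bool (\<not> g False) * pmf p 0"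
proof -
  have eq: "{c. forces g (Suc n) False c} =
      {c. if c [] = 0 then g False else \<forall>i < c []. forces g n True (subtree c [i])}"
    by simp
  show ?thesis
    unfolding forces_prob_def eq by (rule prob_every_child) (rule measurable_pred_forces)
qed

lemma forces_prob_tendsto: "(\<lambda>n. forces_prob g p n m) \<longlonglongrightarrow> win_prob g p m"
proof -
  interpret prob_space "GW p"
    by (rule prob_space_GW)
  have "(\<lambda>n. prob {c. forces g n m c}) \<longlonglongrightarrow> prob (\<Union>n. {c. forces g n m c})"
    by (intro finite_Lim_measure_incseq) 
      (auto simp: incseq_Suc_iff intro: forces_Suc sets_GW_Collect simp del: forces.simps)
  also have "(\<Union>n. {c. forces g n m c}) = {c. eventually_forces g m c}"
    by (auto simp: eventually_forces_def)
  finally show ?thesis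
    by (simp add: win_prob_def forces_prob_def)
qed

subsection \<open>Two-cycles of concave functions\<close>

text \<open>Concavity without denominators, which also covers coinciding points.\<close>

lemma concave_three_points:
  fixes R :: "real \<Rightarrow> real"
  assumes "concave_on S R" "x \<in> S" "z \<in> S" "x \<le> y" "y \<le> z"
  shows "(z - y) * R x + (y - x) * R z \<le> (z - x) * R y"
proof (cases "x = z")
  case False
  with assms have "x < z"
    by simp
  define l where "l = (y - x) / (z - x)"
  have l: "(z - x) * l = y - x"
    using \<open>x < z\<close> by (simp add: l_def)
  then have y: "y = (1 - l) *\<^sub>R x + l *\<^sub>R z"
    by (simp add: algebra_simps)
  have "(1 - l) * R x + l * R z \<le> R y"
    unfolding y using assms \<open>x < z\<close>
    by (intro concave_onD[OF assms(1)]) (auto simp: l_def divide_le_eq)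
  then have "(z - x) * ((1 - l) * R x + l * R z) \<le> (z - x) * R y"
    using \<open>x < z\<close> by (intro mult_left_mono) auto
  moreover have "(z - x) * ((1 - l) * R x + l * R z) = (z - y) * R x + (y - x) * R z"
    using l by algebra
  ultimately show ?thesis
    by simp
qed (use assms in auto)

text \<open>
  The shift by \<open>e\<close> is made in \<open>k\<close> steps of size \<open>2 t\<close>, each small enough (\<open>t \<le> V - U\<close>) that the chord
  of \<open>R\<close> over \<open>[a, b]\<close>, whose slope is at most \<open>- 1\<close>, controls \<open>R\<close> at \<open>a + t\<close> and at \<open>b + t\<close>.
\<close>

lemma two_cycle_shift:
  fixes R :: "real \<Rightarrow> real"
  assumes conc: "concave_on {0..1} R"
    and anti: "\<And>x y. 0 \<le> x \<Longrightarrow> x \<le> y \<Longrightarrow> y \<le> 1 \<Longrightarrow> R y \<le> R x"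
    and R0: "R 0 = 1 - e" and R1: "R 1 = 0" and "0 \<le> e"
    and "0 \<le> U" "U < V" "V \<le> 1" "R V = U" "R U = V"
  obtains b where "V + e / 2 = b" "b \<le> 1" "R b + e \<le> U + e / 2" "b \<le> R (R b + e) + e"
proof -
  obtain k :: nat where k: "e / (2 * (V - U)) < real k"
    using reals_Archimedean2 by blast
  have "0 \<le> e / (2 * (V - U))"
    using assms by auto
  with k have "0 < k"
    by (cases k) auto
  define t where "t = e / (2 * real k)"
  have t: "0 \<le> t" "2 * t * real k = e" "t \<le> V - U"
    using \<open>0 \<le> e\<close> \<open>0 < k\<close> k \<open>U < V\<close> by (auto simp: t_def field_simps)
  \<comment> \<open>Invariant for the shift \<open>2 * t * real j\<close>: \<open>b\<close> is at
    most its image under the second iterate of the shifted function, and the gap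
    \<open>b - a\<close> is still at least \<open>V - U\<close>.\<close>
  let ?I = "\<lambda>j b a. a \<le> U + t * real j \<and> b \<le> 1 \<and> b \<le> R a + 2 * t * real j"
  have "\<exists>b a. V + t * real j = b \<and> R b + 2 * t * real j = a \<and> ?I j b a" if "j \<le> k" for j
    using that
  proof (induction j)
    case 0
    with assms show ?case
      by auto
  next
    case (Suc j)
    then obtain a b where b: "V + t * real j = b" and a: "R b + 2 * t * real j = a"
      and ab: "a \<le> U + t * real j" "b \<le> 1" "b \<le> R a + 2 * t * real j"
      by auto
    have tj: "0 \<le> t * real j"
      using t by simp
    have pos: "0 \<le> R x" if "0 \<le> x" "x \<le> 1" for x
      using anti[of x 1] that R1 by simp
    have b0: "0 \<le> b"
      using b tj assms by linarith
    have a0: "0 \<le> a"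
      using pos[OF b0 ab(2)] a tj by linarith
    have D: "V - U \<le> b - a"
      using ab b by linarith
    have "a \<le> 1"
      using D ab(2) \<open>U < V\<close> by linarith
    have "t * real (Suc j) \<le> t * real k"
      using Suc.prems t by (intro mult_left_mono) auto
    \<comment> \<open>Combines \<open>b \<le> R a + 2 * t * real j\<close>,
      \<open>R a \<le> R 0 = 1 - e\<close> and \<open>2 * t * real (Suc j) \<le> e\<close>.\<close>
    then have "b + 2 * t \<le> 1"
      using anti[of 0 a] a0 \<open>a \<le> 1\<close> R0 ab(3) t(2) by (simp add: algebra_simps)
    then have bt: "b + t \<le> 1"
      using t by linarith
    have slope: "R b - R a \<le> a - b"
      using ab(3) a by linarith
    \<comment> \<open>To the right of \<open>b\<close> a concave function falls at least as steeply
      as along its chord over \<open>[a, b]\<close>.\<close>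
    have "R (b + t) \<le> R b - t"
    proof -
      have "t * R a + (b - a) * R (b + t) \<le> (b + t - a) * R b"
        using concave_three_points[OF conc, of a "b + t" b] a0 bt b0 D t \<open>U < V\<close> \<open>a \<le> 1\<close> by simp
      then have "(b - a) * R (b + t) \<le> (b - a) * R b + t * (R b - R a)"
        by (simp add: algebra_simps)
      also have "\<dots> \<le> (b - a) * R b + t * (a - b)"
        using slope t by (intro add_left_mono mult_left_mono)
      also have "\<dots> = (b - a) * (R b - t)"
        by (simp add: algebra_simps)
      finally show ?thesis
        using D \<open>U < V\<close> by simp
    qed
    then have a': "R (b + t) + 2 * t * real (Suc j) \<le> a + t"
      using a by (simp add: algebra_simps)
    \<comment> \<open>On \<open>[a, b]\<close> the graph lies above its chord, hence above the line
      of slope -1 from \<open>(a, b - 2 * t * real j)\<close> to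
      \<open>(b, a - 2 * t * real j)\<close>.\<close>
    have at: "b - 2 * t * real j - t \<le> R (a + t)"
    proof -
      have "(b - (a + t)) * R a + t * R b \<le> (b - a) * R (a + t)"
        using concave_three_points[OF conc, of a b "a + t"] a0 ab b0 D t \<open>a \<le> 1\<close> by simp
      moreover have "(b - (a + t)) * (b - 2 * t * real j) \<le> (b - (a + t)) * R a"
        using ab D t by (intro mult_left_mono) auto
      moreover have "R b = a - 2 * t * real j"
        using a by simp
      moreover have "(b - (a + t)) * (b - 2 * t * real j) + t * (a - 2 * t * real j) =
          (b - a) * (b - 2 * t * real j - t)"
        by algebra
      ultimately have "(b - a) * (b - 2 * t * real j - t) \<le> (b - a) * R (a + t)"
        by simp
      then show ?thesis
        using D \<open>U < V\<close> by simp
    qed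
    have "0 \<le> R (b + t) + 2 * t * real (Suc j)"
      using pos[of "b + t"] b0 bt t by simp
    then have "R (a + t) \<le> R (R (b + t) + 2 * t * real (Suc j))"
      using a' D t ab(2) by (intro anti) auto
    with at a' ab(1) bt show ?case
      by (intro exI[of _ "b + t"] exI[of _ "R (b + t) + 2 * t * real (Suc j)"])
        (auto simp: algebra_simps simp flip: b)
  qed
  from this[of k] show thesis
    using t(2) by (intro that) (auto simp: algebra_simps)
qed

text \<open>By \<open>max\<close>, \<open>V'\<close> dominates the point \<open>b\<close> of the
  shifted cycle: \<open>V + e / 2 \<le> V'\<close>, hence \<open>U' \<le> U + e / 2\<close>, and the
  gap does not shrink. If \<open>U = V\<close>, the gap claim is \<open>U' \<le> V'\<close>, and
  points with \<open>y \<le> R y + e\<close> are compared with \<open>V'\<close> instead.\<close>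

lemma two_cycle_comparison:
  fixes R :: "real \<Rightarrow> real"
  assumes conc: "concave_on {0..1} R"
    and anti: "\<And>x y. 0 \<le> x \<Longrightarrow> x \<le> y \<Longrightarrow> y \<le> 1 \<Longrightarrow> R y \<le> R x"
    and R0: "R 0 = 1 - e" and R1: "R 1 = 0" and "0 \<le> e"
    and U: "0 \<le> U" "U \<le> V" "V \<le> 1" "R V = U" "R U = V"
    and U': "0 \<le> U'" "U' \<le> V'" "V' \<le> 1" "R V' + e = U'"
    and max: "\<And>w. 0 \<le> w \<Longrightarrow> w \<le> 1 \<Longrightarrow> w \<le> R (R w + e) + e \<Longrightarrow> w \<le> V'"
  shows "V \<le> V'" "1 - U \<le> V'" "V - U \<le> V' - U'"
proof -
  have "V \<le> V' \<and> 1 - U \<le> V' \<and> V - U \<le> V' - U'"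
  proof (cases "U < V")
    case True
    then obtain b where b: "V + e / 2 = b" "b \<le> 1" "R b + e \<le> U + e / 2" "b \<le> R (R b + e) + e"
      using two_cycle_shift[OF conc anti R0 R1] U \<open>0 \<le> e\<close> by blast
    have "0 \<le> b"
      using U b(1) \<open>0 \<le> e\<close> by linarith
    then have "b \<le> V'"
      using max b by blast
    moreover from this have "U' \<le> R b + e"
      using anti[of b V'] \<open>0 \<le> b\<close> U' by simp
    \<comment> \<open>Concavity at \<open>V\<close> between \<open>U\<close> and 1 forces
      \<open>U + V \<ge> 1\<close> for a genuine cycle, so
      \<open>1 - U \<le> V \<le> V'\<close>.\<close>
    moreover have "(1 - V) * V + (V - U) * 0 \<le> (1 - U) * U"
      using concave_three_points[OF conc, of U 1 V] U R1 by simp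
    then have "0 \<le> (V - U) * (U + V - 1)"
      by (simp add: algebra_simps)
    then have "0 \<le> U + V - 1"
      using True by (simp add: zero_le_mult_iff)
    ultimately show ?thesis
      using b \<open>0 \<le> e\<close> by linarith
  next
    case False
    with U have [simp]: "V = U"
      by simp
    have below: "y \<le> V'" if "0 \<le> y" "y \<le> 1" "y \<le> R y + e" for y
    proof (rule ccontr)
      assume "\<not> y \<le> V'"
      then show False
        using anti[of V' y] U' that by linarith
    qed
    have "U \<le> V'"
      using below[of U] U \<open>0 \<le> e\<close> by simp
    moreover have "1 - U \<le> V'" if "U < 1 / 2"
    proof (rule below)
      \<comment> \<open>Two chords ending at 1: the one from 0, at \<open>U\<close>, gives
        \<open>(1 - U) * e \<ge> 1 - 2 * U\<close>; the one from \<open>U\<close>, at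
        \<open>1 - U\<close>, gives \<open>(1 - U) * R (1 - U) \<ge> U * U\<close>. The right sides
        add up to the square of \<open>1 - U\<close>.\<close>
      have "(1 - U) * R 0 \<le> R U"
        using concave_three_points[OF conc, of 0 1 U] U R1 by simp
      then have "1 - 2 * U \<le> (1 - U) * e"
        using U R0 by (simp add: algebra_simps)
      moreover have "U * U \<le> (1 - U) * R (1 - U)"
        using concave_three_points[OF conc, of U 1 "1 - U"] U R1 that by simp
      ultimately have "(1 - U) * (1 - U) \<le> (1 - U) * (R (1 - U) + e)"
        by (simp add: algebra_simps)
      then show "1 - U \<le> R (1 - U) + e"
        using that by simp
    qed (use U in auto)
    ultimately show ?thesis
      using U' by (cases "U < 1 / 2") auto
  qed
  then show "V \<le> V'" "1 - U \<le> V'" "V - U \<le> V' - U'"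
    by auto
qed

subsection \<open>The inequalities\<close>

lemma win_prob_range: "0 \<le> win_prob g p m" "win_prob g p m \<le> 1"
  using prob_space.prob_le_1[OF prob_space_GW] by (auto simp: win_prob_def)

lemma forces_prob_range: "0 \<le> forces_prob g p n m" "forces_prob g p n m \<le> 1"
  using prob_space.prob_le_1[OF prob_space_GW] by (auto simp: forces_prob_def)

text \<open>The system is monotone, so its iterates from 0 stay below any pair that it does not
  increase. This gives the maximality of the misere cycle and the numerical upper bounds.\<close>

lemma win_prob_least:
  assumes "\<alpha> \<le> 1" "\<beta> \<le> 1" "0 \<le> \<alpha>" "0 \<le> \<beta>"
    and \<alpha>: "of_bool (g True) * pmf p 0 + 1 - pgf p (1 - \<beta>) \<le> \<alpha>"
    and \<beta>: "pgf p \<alpha> - of_bool (\<not> g False) * pmf p 0 \<le> \<beta>"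
  shows "win_prob g p True \<le> \<alpha>" "win_prob g p False \<le> \<beta>"
proof -
  have "forces_prob g p n True \<le> \<alpha> \<and> forces_prob g p n False \<le> \<beta>" for n
  proof (induction n)
    case (Suc n)
    then have "pgf p (1 - \<beta>) \<le> pgf p (1 - forces_prob g p n False)"
      "pgf p (forces_prob g p n True) \<le> pgf p \<alpha>"
      using assms forces_prob_range by (intro pgf_mono; simp)+
    with \<alpha> \<beta> show ?case
      by (simp add: forces_prob_Suc_True forces_prob_Suc_False)
  qed (use assms in simp)
  then show "win_prob g p True \<le> \<alpha>" "win_prob g p False \<le> \<beta>"
    by (auto intro: LIMSEQ_le_const2[OF forces_prob_tendsto])
qed

text \<open>Winning in both roles passes to the subtree chosen by the hero's first move, with a
  smaller bound; at a childless root \<open>g\<close> excludes it.\<close>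

lemma not_forces_both:
  "\<not> (g True \<and> g False) \<Longrightarrow> \<not> (forces g n True c \<and> forces g n False c)"
proof (induction n arbitrary: c)
  case (Suc n)
  then have "\<not> (forces g n True (subtree c [i]) \<and> forces g n False (subtree c [i]))" for i
    by blast
  with Suc.prems show ?case
    by (auto split: if_splits)
qed simp

lemma not_eventually_forces_both:
  assumes "\<not> (g True \<and> g False)" "eventually_forces g True c"
  shows "\<not> eventually_forces g False c"
proof
  assume "eventually_forces g False c"
  with assms(2) obtain n n' where "forces g n True c" "forces g n' False c"
    by (auto simp: eventually_forces_def)
  then have "forces g (max n n') True c" "forces g (max n n') False c"
    by (auto intro: forces_mono)
  with not_forces_both assms(1) show False
    by blast
qed

lemma prob_draw:
  assumes "\<not> (g True \<and> g False)"
  shows "measure (GW p) {c. \<not> eventually_forces g True c \<and> \<not> eventually_forces g False c} =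
    1 - win_prob g p True - win_prob g p False"
proof -
  interpret prob_space "GW p"
    by (rule prob_space_GW)
  let ?W = "\<lambda>m. {c. eventually_forces g m c}"
  have W: "?W m \<in> events" for m
    by (rule sets_GW_Collect) measurable
  have "{c. \<not> eventually_forces g True c \<and> \<not> eventually_forces g False c} =
      space (GW p) - (?W True \<union> ?W False)"
    by auto
  also have "prob \<dots> = 1 - prob (?W True \<union> ?W False)"
    using W by (intro prob_compl) auto
  also have "prob (?W True \<union> ?W False) = prob (?W True) + prob (?W False)"
    using W not_eventually_forces_both[OF assms] by (intro finite_measure_Union) auto
  finally show ?thesis
    by (simp add: win_prob_def)
qed

lemma prob_not_win:
  "measure (GW p) {c. \<not> eventually_forces g m c} = 1 - win_prob g p m"
proof -
  interpret prob_space "GW p"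
    by (rule prob_space_GW)
  have "{c. eventually_forces g m c} \<in> events"
    by (rule sets_GW_Collect) measurable
  then show ?thesis
    using prob_neg[of "eventually_forces g m"] by (simp add: win_prob_def)
qed

lemma win_prob_add_le_1:
  "\<not> (g True \<and> g False) \<Longrightarrow> win_prob g p True + win_prob g p False \<le> 1"
  using prob_draw[of g p, symmetric] measure_nonneg[of "GW p"] by (smt (verit))

section \<open>The ten outcomes in terms of winning probabilities\<close>

abbreviation "normal_prob \<equiv> win_prob Not"
abbreviation "misere_prob \<equiv> win_prob (\<lambda>m. m)"
abbreviation "stopper_prob \<equiv> win_prob (\<lambda>_. True)"

lemma outcome_prob_simps:
  "outcome_prob p NormalN = normal_prob p True"
  "outcome_prob p NormalP = normal_prob p False"
  "outcome_prob p NormalD = 1 - normal_prob p True - normal_prob p False"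
  "outcome_prob p MisereN = misere_prob p True"
  "outcome_prob p MisereP = misere_prob p False"
  "outcome_prob p MisereD = 1 - misere_prob p True - misere_prob p False"
  "outcome_prob p Stopper1 = stopper_prob p True"
  "outcome_prob p Stopper2 = stopper_prob p False"
  "outcome_prob p Escaper1 = 1 - stopper_prob p False"
  "outcome_prob p Escaper2 = 1 - stopper_prob p True"
proof -
  show "outcome_prob p NormalD = 1 - normal_prob p True - normal_prob p False"
    using prob_draw[of Not p] by (simp add: outcome_prob_def first_wins_forces second_wins_forces)
  show "outcome_prob p MisereD = 1 - misere_prob p True - misere_prob p False"
    using prob_draw[of "\<lambda>m. m" p]
    by (simp add: outcome_prob_def first_wins_forces second_wins_forces)
  show "outcome_prob p Escaper1 = 1 - stopper_prob p False"
    "outcome_prob p Escaper2 = 1 - stopper_prob p True"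
    using prob_not_win[of p "\<lambda>_. True"]
    by (simp_all add: outcome_prob_def first_wins_forces second_wins_forces)
qed (simp_all add: outcome_prob_def win_prob_def first_wins_forces second_wins_forces)

lemma forces_weaken:
  "forces g n m c \<Longrightarrow> (\<And>m. g m \<Longrightarrow> g' m) \<Longrightarrow> forces g' n m c"
proof (induction n arbitrary: m c)
  case (Suc n)
  then have IH: "forces g n m' (subtree c [i]) \<Longrightarrow> forces g' n m' (subtree c [i])" for i m'
    by blast
  have "g m \<Longrightarrow> g' m"
    by (rule Suc.prems)
  with IH Suc.prems(1) show ?case
    by (auto split: if_splits)
qed simp

text \<open>With \<open>g'\<close> constantly true this is (i).\<close>

lemma win_prob_weaken:
  assumes "\<And>m. g m \<Longrightarrow> g' m"
  shows "win_prob g p m \<le> win_prob g' p m"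
proof -
  interpret prob_space "GW p"
    by (rule prob_space_GW)
  have "{c. eventually_forces g' m c} \<in> events"
    by (rule sets_GW_Collect) measurable
  moreover have "{c. eventually_forces g m c} \<subseteq> {c. eventually_forces g' m c}"
    using forces_weaken assms unfolding eventually_forces_def by blast
  ultimately show ?thesis
    unfolding win_prob_def by (intro finite_measure_mono)
qed

text \<open>By convexity the graph lies below the chord from \<open>(0, pmf p 0)\<close> to
  \<open>(1, 1)\<close>, whose heights at \<open>x\<close> and \<open>1 - x\<close> add up to the
  right side.\<close>

lemma pgf_add_pgf_complement_le:
  assumes "0 \<le> x" "x \<le> 1"
  shows "pgf p x + pgf p (1 - x) \<le> 1 + pmf p 0"
proof -
  have chord: "pgf p y \<le> (1 - y) * pmf p 0 + y" if "0 \<le> y" "y \<le> 1" for y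
    using convex_onD[OF convex_on_pgf, of y 0 1 p] that by simp
  show ?thesis
    using chord[of x] chord[of "1 - x"] assms by (simp add: algebra_simps)
qed

text \<open>This is (ii), for the misere game and for Stopper. If \<open>?t\<close> exceeded
  \<open>?s\<close>, the chord bound would give \<open>pgf p ?s \<le> ?s\<close>, while always
  \<open>?t \<le> pgf p ?s\<close>.\<close>

lemma win_prob_second_le_first:
  assumes "g True"
  shows "win_prob g p False \<le> win_prob g p True"
proof (rule ccontr)
  let ?s = "win_prob g p True" and ?t = "win_prob g p False"
  note range = win_prob_range[of g p]
  assume "\<not> ?t \<le> ?s"
  then have "pgf p (1 - ?t) \<le> pgf p (1 - ?s)"
    using range by (intro pgf_mono) auto
  with pgf_add_pgf_complement_le[of ?s p] range have "pgf p ?s \<le> 1 + pmf p 0 - pgf p (1 - ?t)"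
    by simp
  also have "\<dots> = ?s"
    using win_prob_True[of g p] assms by simp
  finally have "pgf p ?s \<le> ?s" .
  moreover have "0 \<le> of_bool (\<not> g False) * pmf p 0"
    by simp
  ultimately have "?t \<le> ?s"
    using win_prob_False[of g p] by linarith
  with \<open>\<not> ?t \<le> ?s\<close> show False
    by simp
qed

text \<open>The cycle comparison with \<open>e = pmf p 0\<close>, \<open>U = N\<close>,
  \<open>V = 1 - P\<close> and the corresponding misere values as \<open>U'\<close>,
  \<open>V'\<close>; the gap of a cycle is the draw probability.\<close>

lemma misere_normal_comparison:
  "misere_prob p False \<le> normal_prob p False"
  "misere_prob p False \<le> normal_prob p True"
  "1 - normal_prob p True - normal_prob p False \<le> 1 - misere_prob p True - misere_prob p False"
proof -
  let ?R = "\<lambda>x. 1 - pgf p x"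
  have conc: "concave_on {0..1} ?R"
    using convex_on_add[OF convex_on_pgf, of "\<lambda>_. - 1" p]
    by (simp add: concave_on_def convex_on_const)
  have anti: "?R y \<le> ?R x" if "0 \<le> x" "x \<le> y" "y \<le> 1" for x y
    using pgf_mono[OF that] by simp
  \<comment> \<open>If \<open>w\<close> lies below its second image, the pair
    \<open>?R w + pmf p 0\<close>, \<open>1 - w\<close> bounds the least solution from
    above.\<close>
  have max: "w \<le> 1 - misere_prob p False"
    if w: "0 \<le> w" "w \<le> 1" "w \<le> ?R (?R w + pmf p 0) + pmf p 0" for w
  proof -
    have "pmf p 0 \<le> pgf p w" "pgf p w \<le> 1"
      using pgf_mono[of 0 w p] pgf_mono[of w 1 p] w by simp_all
    then have "misere_prob p False \<le> 1 - w"
      using w by (intro win_prob_least(2)[where \<alpha> = "?R w + pmf p 0"]) auto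
    then show ?thesis
      by simp
  qed
  have normal: "normal_prob p True = ?R (1 - normal_prob p False)"
    "1 - normal_prob p False = ?R (normal_prob p True)"
    using win_prob_True[of Not p] win_prob_False[of Not p] by simp_all
  have misere: "misere_prob p True = ?R (1 - misere_prob p False) + pmf p 0"
    using win_prob_True[of "\<lambda>m. m" p] by simp
  have U: "0 \<le> normal_prob p True" "normal_prob p True \<le> 1 - normal_prob p False"
    "1 - normal_prob p False \<le> 1"
    using win_prob_range(1)[of Not p] win_prob_add_le_1[of Not p] by (simp_all add: algebra_simps)
  have U': "0 \<le> misere_prob p True" "misere_prob p True \<le> 1 - misere_prob p False"
    "1 - misere_prob p False \<le> 1"
    using win_prob_range(1)[of "\<lambda>m. m" p] win_prob_add_le_1[of "\<lambda>m. m" p]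
    by (simp_all add: algebra_simps)
  have "1 - normal_prob p False \<le> 1 - misere_prob p False"
    "1 - normal_prob p True \<le> 1 - misere_prob p False"
    "1 - normal_prob p False - normal_prob p True \<le> 1 - misere_prob p False - misere_prob p True"
    by (rule two_cycle_comparison[OF conc _ _ _ _ U normal[symmetric] U' misere[symmetric]];
        (erule (2) anti | erule (2) max | simp))+
  then show "misere_prob p False \<le> normal_prob p False"
    "misere_prob p False \<le> normal_prob p True"
    "1 - normal_prob p True - normal_prob p False \<le> 1 - misere_prob p True - misere_prob p False"
    by auto
qed

subsection \<open>Strict inequalities\<close>

text \<open>Half a step of the iteration from 0; alternated with its counterpart for
  \<open>False\<close> and rounded down, it yields the numerical lower bounds.\<close>

lemma win_prob_True_ge:
  assumes "\<beta> \<le> win_prob g p False" "0 \<le> \<beta>"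
    and "x \<le> of_bool (g True) * pmf p 0 + 1 - pgf p (1 - \<beta>)"
  shows "x \<le> win_prob g p True"
proof -
  have "pgf p (1 - win_prob g p False) \<le> pgf p (1 - \<beta>)"
    using assms win_prob_range[of g p] by (intro pgf_mono) auto
  with assms show ?thesis
    by (simp add: win_prob_True[of g p])
qed

lemma win_prob_False_ge:
  assumes "\<alpha> \<le> win_prob g p True" "0 \<le> \<alpha>"
    and "x \<le> pgf p \<alpha> - of_bool (\<not> g False) * pmf p 0"
  shows "x \<le> win_prob g p False"
proof -
  have "pgf p \<alpha> \<le> pgf p (win_prob g p True)"
    using assms win_prob_range[of g p] by (intro pgf_mono) auto
  with assms show ?thesis
    by (simp add: win_prob_False[of g p])
qed

section \<open>The distributions used as witnesses\<close>

lemma pgf_return_pmf [simp]: "pgf (return_pmf k) x = x ^ k"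
  by (simp add: pgf_def)

lemma pgf_map_pmf: "pgf (map_pmf f q) x = measure_pmf.expectation q (\<lambda>i. x ^ f i)"
  by (simp add: pgf_def)

definition two_point_pmf :: "real \<Rightarrow> nat \<Rightarrow> nat pmf" where
  "two_point_pmf r k = map_pmf (\<lambda>b. if b then k else 0) (bernoulli_pmf r)"

lemma pgf_two_point_pmf:
  "0 \<le> r \<Longrightarrow> r \<le> 1 \<Longrightarrow> pgf (two_point_pmf r k) x = 1 - r + r * x ^ k"
  by (simp add: two_point_pmf_def pgf_map_pmf)

lemma pmf_two_point_pmf_0:
  "0 \<le> r \<Longrightarrow> r \<le> 1 \<Longrightarrow> 0 < k \<Longrightarrow> pmf (two_point_pmf r k) 0 = 1 - r"
  by (subst pgf_0[symmetric]) (simp add: pgf_two_point_pmf power_0_left del: pgf_0)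

text \<open>Eight equally likely entries encode the weights 1/8, 1/2, 3/8 on 0, 1, 8, so
  expectations are finite averages.\<close>

definition three_point_pmf :: "nat pmf" where
  "three_point_pmf = map_pmf (\<lambda>i. [0, 1, 1, 1, 1, 8, 8, 8] ! i) (pmf_of_set {..<8})"

lemma pgf_three_point_pmf: "pgf three_point_pmf x = 1 / 8 + x / 2 + 3 / 8 * x ^ 8"
proof -
  have "{..<8::nat} = {0, 1, 2, 3, 4, 5, 6, 7}"
    by auto
  then show ?thesis
    by (simp add: three_point_pmf_def pgf_map_pmf integral_pmf_of_set field_simps)
qed

lemma pmf_three_point_pmf_0: "pmf three_point_pmf 0 = 1 / 8"
  by (subst pgf_0[symmetric]) (simp add: pgf_three_point_pmf del: pgf_0)

text \<open>On a single vertex the first player is stuck at once, so each outcome is certain or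
  impossible.\<close>

lemma strict_ineq_leaf:
  assumes "A \<in> {NormalP, MisereN, Stopper1, Stopper2}"
    and "B \<in> {NormalN, NormalD, MisereP, MisereD, Escaper1, Escaper2}"
  shows "\<exists>p. outcome_prob p A > outcome_prob p B"
proof -
  let ?p = "return_pmf 0 :: nat pmf"
  have "win_prob g ?p True = of_bool (g True)" "win_prob g ?p False = of_bool (g False)" for g
    using win_prob_True[of g ?p] win_prob_False[of g ?p] by auto
  with assms show ?thesis
    by (intro exI[of _ ?p]) (auto simp: outcome_prob_simps)
qed

text \<open>The tree is an infinite ray, on which no play ends.\<close>

lemma strict_ineq_ray:
  assumes "A \<in> {NormalD, MisereD, Escaper1, Escaper2}"
    and "B \<in> {NormalN, NormalP, MisereN, MisereP, Stopper1, Stopper2}"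
  shows "\<exists>p. outcome_prob p A > outcome_prob p B"
proof -
  let ?p = "return_pmf 1 :: nat pmf"
  have "win_prob g ?p m = 0" for g m
    using win_prob_least[of 0 0 g ?p] win_prob_range[of g ?p m] by (cases m) auto
  with assms show ?thesis
    by (intro exI[of _ ?p]) (auto simp: outcome_prob_simps)
qed

text \<open>The tree is a path of geometric length: its parity decides the normal and misere games,
  and Stopper wins almost surely.\<close>

lemma strict_ineq_finite_path:
  assumes "(A, B) \<in> {NormalN, MisereP} \<times> {NormalD, MisereD, Escaper1, Escaper2} \<union>
    {Stopper1, Stopper2} \<times> {NormalP, MisereN}"
  shows "\<exists>p. outcome_prob p A > outcome_prob p B"
proof -
  let ?p = "two_point_pmf (1 / 2) 1"
  have eqs: "win_prob g ?p True = of_bool (g True) / 2 + win_prob g ?p False / 2"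
    "win_prob g ?p False = 1 / 2 + win_prob g ?p True / 2 - of_bool (\<not> g False) / 2" for g
    using win_prob_True[of g ?p] win_prob_False[of g ?p]
    by (auto simp: pgf_two_point_pmf pmf_two_point_pmf_0 field_simps)
  have "normal_prob ?p True = normal_prob ?p False / 2"
    "normal_prob ?p False = 1 / 2 + normal_prob ?p True / 2"
    "misere_prob ?p True = 1 / 2 + misere_prob ?p False / 2"
    "misere_prob ?p False = misere_prob ?p True / 2"
    "stopper_prob ?p True = 1 / 2 + stopper_prob ?p False / 2"
    "stopper_prob ?p False = 1 / 2 + stopper_prob ?p True / 2"
    by (subst eqs; simp)+
  then have "normal_prob ?p True = 1 / 3" "normal_prob ?p False = 2 / 3"
    "misere_prob ?p True = 2 / 3" "misere_prob ?p False = 1 / 3"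
    "stopper_prob ?p True = 1" "stopper_prob ?p False = 1"
    by linarith+
  with assms show ?thesis
    by (intro exI[of _ ?p]) (auto simp: outcome_prob_simps)
qed

text \<open>With rare leaves, the first player wins the normal game mainly by moving to a leaf among
  three children, but the misere game mainly by starting on a leaf. The tightest pair is P, at least
  33/500, against misere N, at most 13/200.\<close>

lemma strict_ineq_sparse_leaves:
  assumes "(A, B) \<in> {NormalN} \<times> {NormalP, MisereN, MisereP, Stopper2} \<union>
    {(NormalP, MisereN), (MisereD, NormalD), (Stopper1, Stopper2), (Escaper1, Escaper2)}"
  shows "\<exists>p. outcome_prob p A > outcome_prob p B"
proof -
  let ?p = "two_point_pmf (15 / 16) 3"
  have G: "pgf ?p x = 1 / 16 + 15 / 16 * x ^ 3" for x
    by (simp add: pgf_two_point_pmf)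
  have p0: "pmf ?p 0 = 1 / 16"
    by (simp add: pmf_two_point_pmf_0)
  note ineq = G p0 power3_eq_cube
  have n: "normal_prob ?p False \<le> 7 / 100"
    by (rule win_prob_least(2)[where \<alpha> = "19 / 100"]) (simp_all add: ineq)
  have m: "misere_prob ?p True \<le> 13 / 200" "misere_prob ?p False \<le> 1 / 2000"
    by (rule win_prob_least[where \<alpha> = "13 / 200" and \<beta> = "1 / 2000"]; simp add: ineq)+
  have s: "stopper_prob ?p False \<le> 9 / 100"
    by (rule win_prob_least(2)[where \<alpha> = "3 / 10"]) (simp_all add: ineq)
  have "1 / 16 \<le> normal_prob ?p False"
    by (rule win_prob_False_ge[where \<alpha> = 0]) (simp_all add: ineq win_prob_range)
  then have n1: "4 / 25 \<le> normal_prob ?p True"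
    by (rule win_prob_True_ge) (simp_all add: ineq)
  then have n2: "33 / 500 \<le> normal_prob ?p False"
    by (rule win_prob_False_ge) (simp_all add: ineq)
  have "1 / 16 \<le> stopper_prob ?p False"
    by (rule win_prob_False_ge[where \<alpha> = 0]) (simp_all add: ineq win_prob_range)
  then have "22 / 100 \<le> stopper_prob ?p True"
    by (rule win_prob_True_ge) (simp_all add: ineq)
  with n m s n1 n2 assms show ?thesis
    by (intro exI[of _ ?p]) (auto simp: outcome_prob_simps)
qed

text \<open>Normal draws have probability at least 21/100, misere draws are no rarer by (iii), and
  Escaper wins with probability at most 1/20.\<close>

lemma strict_ineq_draw_without_escape:
  assumes "A \<in> {NormalD, MisereD}" "B \<in> {Escaper1, Escaper2}"
  shows "\<exists>p. outcome_prob p A > outcome_prob p B"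
proof -
  let ?p = "two_point_pmf (17 / 20) 3"
  have G: "pgf ?p x = 3 / 20 + 17 / 20 * x ^ 3" for x
    by (simp add: pgf_two_point_pmf)
  have p0: "pmf ?p 0 = 3 / 20"
    by (simp add: pmf_two_point_pmf_0)
  note ineq = G p0 power3_eq_cube
  have n: "normal_prob ?p True \<le> 13 / 25" "normal_prob ?p False \<le> 27 / 100"
    by (rule win_prob_least[where \<alpha> = "13 / 25" and \<beta> = "27 / 100"]; simp add: ineq)+
  note True_ge = win_prob_True_ge[where p = ?p and g = "\<lambda>_. True"]
  note False_ge = win_prob_False_ge[where p = ?p and g = "\<lambda>_. True"]
  \<comment> \<open>The iteration starts at 0, whose image is \<open>pmf ?p 0\<close>, and runs
    until both values are close to 1.\<close>
  have "3 / 20 \<le> stopper_prob ?p False"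
    by (rule False_ge[where \<alpha> = 0]) (simp_all add: ineq win_prob_range)
  then have "47 / 100 \<le> stopper_prob ?p True"
    by (rule True_ge) (simp_all add: ineq)
  then have "23 / 100 \<le> stopper_prob ?p False"
    by (rule False_ge) (simp_all add: ineq)
  then have "61 / 100 \<le> stopper_prob ?p True"
    by (rule True_ge) (simp_all add: ineq)
  then have "17 / 50 \<le> stopper_prob ?p False"
    by (rule False_ge) (simp_all add: ineq)
  then have "3 / 4 \<le> stopper_prob ?p True"
    by (rule True_ge) (simp_all add: ineq)
  then have "1 / 2 \<le> stopper_prob ?p False"
    by (rule False_ge) (simp_all add: ineq)
  then have "89 / 100 \<le> stopper_prob ?p True"
    by (rule True_ge) (simp_all add: ineq)
  then have "37 / 50 \<le> stopper_prob ?p False"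
    by (rule False_ge) (simp_all add: ineq)
  then have s: "49 / 50 \<le> stopper_prob ?p True"
    by (rule True_ge) (simp_all add: ineq)
  then have "19 / 20 \<le> stopper_prob ?p False"
    by (rule False_ge) (simp_all add: ineq)
  with s n misere_normal_comparison(3)[of ?p] assms show ?thesis
    by (intro exI[of _ ?p]) (auto simp: outcome_prob_simps)
qed

text \<open>Misere N is at least 61/100, above the bounds 43/100 for P and 29/50 for Stopper moving
  second. Misere draws have probability at most 9/100, normal draws no more by (iii), while Escaper
  wins with probability at least 21/100.\<close>

lemma strict_ineq_escape_without_draw:
  assumes "A = MisereN \<and> B \<in> {NormalP, Stopper2} \<or>
    A \<in> {Escaper1, Escaper2} \<and> B \<in> {NormalD, MisereD}"
  shows "\<exists>p. outcome_prob p A > outcome_prob p B"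
proof -
  let ?p = three_point_pmf
  note ineq = pgf_three_point_pmf pmf_three_point_pmf_0 power_divide
  have n: "normal_prob ?p False \<le> 43 / 100"
    by (rule win_prob_least(2)[where \<alpha> = "59 / 100"]) (simp_all add: ineq)
  have s: "stopper_prob ?p True \<le> 79 / 100" "stopper_prob ?p False \<le> 29 / 50"
    by (rule win_prob_least[where \<alpha> = "79 / 100" and \<beta> = "29 / 50"]; simp add: ineq)+
  note True_ge = win_prob_True_ge[where p = ?p and g = "\<lambda>m. m"]
  note False_ge = win_prob_False_ge[where p = ?p and g = "\<lambda>m. m"]
  have "12 / 100 \<le> misere_prob ?p True"
    by (rule True_ge[where \<beta> = 0]) (simp_all add: ineq win_prob_range)
  then have "6 / 100 \<le> misere_prob ?p False"
    by (rule False_ge) (simp_all add: ineq)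
  then have "30 / 100 \<le> misere_prob ?p True"
    by (rule True_ge) (simp_all add: ineq)
  then have "15 / 100 \<le> misere_prob ?p False"
    by (rule False_ge) (simp_all add: ineq)
  then have "47 / 100 \<le> misere_prob ?p True"
    by (rule True_ge) (simp_all add: ineq)
  then have "23 / 100 \<le> misere_prob ?p False"
    by (rule False_ge) (simp_all add: ineq)
  then have "56 / 100 \<le> misere_prob ?p True"
    by (rule True_ge) (simp_all add: ineq)
  then have "28 / 100 \<le> misere_prob ?p False"
    by (rule False_ge) (simp_all add: ineq)
  then have m: "61 / 100 \<le> misere_prob ?p True"
    by (rule True_ge) (simp_all add: ineq)
  then have "30 / 100 \<le> misere_prob ?p False"
    by (rule False_ge) (simp_all add: ineq)
  with m s n win_prob_second_le_first[of "\<lambda>_. True" ?p] misere_normal_comparison(3)[of ?p] assms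
  show ?thesis
    by (intro exI[of _ ?p]) (auto simp: outcome_prob_simps)
qed

theorem theorem2:
  shows "(\<forall>p :: nat pmf.
            (outcome_prob p NormalN \<le> outcome_prob p Stopper1
              \<and> outcome_prob p MisereN \<le> outcome_prob p Stopper1
              \<and> outcome_prob p NormalP \<le> outcome_prob p Stopper2
              \<and> outcome_prob p MisereP \<le> outcome_prob p Stopper2)
          \<and> (outcome_prob p Stopper2 \<le> outcome_prob p Stopper1
              \<and> outcome_prob p MisereP \<le> outcome_prob p MisereN)
          \<and> (outcome_prob p MisereP \<le> outcome_prob p NormalP
              \<and> outcome_prob p MisereP \<le> outcome_prob p NormalN
              \<and> outcome_prob p NormalD \<le> outcome_prob p MisereD))
       \<and> (\<forall>A B :: outcome. A \<noteq> B \<and> \<not> implied_ineq A B \<longrightarrow>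
            (\<exists>p :: nat pmf. outcome_prob p A > outcome_prob p B))"
proof (intro conjI allI impI)
  \<comment> \<open>Of the 90 ordered pairs of distinct outcomes 12 are implied; the six lemmas
    share out the other 78.\<close>
  fix A B :: outcome
  assume "A \<noteq> B \<and> \<not> implied_ineq A B"
  then show "\<exists>p. outcome_prob p A > outcome_prob p B"
    using strict_ineq_leaf[of A B] strict_ineq_ray[of A B] strict_ineq_finite_path[of A B] strict_ineq_sparse_leaves[of A B]
      strict_ineq_draw_without_escape[of A B] strict_ineq_escape_without_draw[of A B]
    by (cases A; cases B) (simp_all add: implied_ineq_iff listed_ineqs_def)
qed (simp_all add: outcome_prob_simps win_prob_weaken win_prob_second_le_first
    misere_normal_comparison[simplified])

end
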